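(* Let $p$ be a prime number, let $n>m>0$ be integers, let $a\in\mathbb{F}_p^{*}$, and let $d=\gcd(n-m,p-1)$. If the polynomial $f(x)=ax^{n}+x^{m}$ permutes $\mathbb{F}_p$, then $p-1\leq (d-1)d$.
   Context: $\mathbb{F}_p$ is the finite field with $p$ elements. A polynomial $f(x)\in\mathbb{F}_p[x]$ permutes $\mathbb{F}_p$ if the induced map $c\mapsto f(c)$ from $\mathbb{F}_p$ to $\mathbb{F}_p$ is one to one. *)

theory Defs
  imports "HOL-Computational_Algebra.Computational_Algebra" "HOL-Library.Cardinality"
begin

definition permutation_poly :: "'a::{field,finite} poly \<Rightarrow> bool" where
  "permutation_poly f \<longleftrightarrow> inj (poly f)"

end

theory Submission
  imports Defs "HOL-Number_Theory.Cong"
begin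

text \<open>
  Write \<open>p - 1 = d s\<close> and \<open>n - m = d e\<close>, so that \<open>e\<close> is invertible modulo \<open>s\<close>, and pick \<open>M\<close> with
  \<open>e M \<equiv> - m (mod s)\<close>. Since \<open>f\<close> permutes the field, its power sum of exponent \<open>d k\<close> vanishes for
  \<open>0 < k < s\<close>. Expanding \<open>f ^ (d k)\<close>, only the terms with index \<open>j \<equiv> k M (mod s)\<close> contribute, and their
  binomial coefficients are nonzero because \<open>d k < p\<close>; hence the interval \<open>[0, d k]\<close> never
  contains exactly one such \<open>j\<close>. An elementary argument on the multiples of \<open>M\<close> modulo \<open>s\<close> shows
  that this is impossible if \<open>2 \<le> d < s\<close>, whereas the claim is \<open>s < d\<close>. If \<open>d = s\<close>, the case \<open>k = 1\<close> forces \<open>d\<close> to divide \<open>m\<close>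
  and \<open>n\<close>, so \<open>f\<close> is a function of \<open>x ^ d\<close>; if \<open>d = 1\<close>, then \<open>f\<close> has a nonzero root.
\<close>

section \<open>Multiples of a residue modulo \<open>s\<close>\<close>

lemma ceiling_multiple:
  fixes s b :: nat
  assumes "0 < b"
  obtains k where "s \<le> b * k" and "b * k < s + b"
proof
  have "s + b - 1 = b * ((s + b - 1) div b) + (s + b - 1) mod b" by simp
  moreover have "(s + b - 1) mod b < b" using assms by simp
  ultimately show "s \<le> b * ((s + b - 1) div b)" "b * ((s + b - 1) div b) < s + b"
    using assms by linarith+
qed

text \<open>
  If no \<open>k\<close> works, the two residues at \<open>k = \<lceil>(s - 1) / d\<rceil>\<close> and at the next index are both small.
  So their difference \<open>M\<close> is close to \<open>0\<close> or to \<open>s\<close>, and the first multiple of \<open>M\<close> reaching \<open>s\<close>,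
  respectively the first \<open>k\<close> with \<open>(s - M + d) k \<ge> s\<close>, supplies such a \<open>k\<close>.
\<close>
lemma multiples_enter_window:
  fixes s d M :: nat
  assumes d: "2 \<le> d" "d < s" and M: "M < s"
  shows "\<exists>k. 0 < k \<and> k < s \<and> k * M mod s \<le> d * k \<and> d * k < k * M mod s + s"
proof (rule ccontr)
  assume "\<not> ?thesis"
  then have gap: "d * k < k * M mod s \<or> k * M mod s + s \<le> d * k" if "0 < k" "k < s" for k
    using that by (meson not_le)
  have dM: "d < M" using gap[of 1] d M by auto
  obtain k0 where k0: "s - 1 \<le> d * k0" "d * k0 < s - 1 + d"
    using ceiling_multiple[of d "s - 1"] d by auto
  define t where "t = k0 * M mod s"
  have k0_pos: "0 < k0" using k0 d by (cases k0) auto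
  \<comment> \<open>Otherwise \<open>(d - 1) * (s - 1) < d\<close>, which is impossible for
    \<open>2 \<le> d < s\<close>.\<close>
  have k0_less: "Suc k0 < s"
  proof (rule ccontr)
    assume "\<not> ?thesis"
    then have "d * (s - 1) \<le> d * k0" by (intro mult_left_mono) auto
    then have "d * (s - 1) < s - 1 + d" using k0 by linarith
    moreover obtain d' where d': "d = d' + 2" using d(1) by (metis le_add_diff_inverse2)
    moreover have "d' * 2 \<le> d' * (s - 1)" using d by (intro mult_left_mono) auto
    moreover have "d * (s - 1) = d' * (s - 1) + 2 * (s - 1)" by (simp add: d' distrib_right)
    ultimately show False using d by linarith
  qed
  have t_less: "t < s" unfolding t_def using d by simp
  \<comment> \<open>Since \<open>d * k0 \<ge> s - 1\<close> is at least every residue, the first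
    alternative of \<open>gap\<close> fails, here and at \<open>Suc k0\<close>.\<close>
  have t: "t + s \<le> d * k0" using gap[of k0] k0_pos k0_less t_less k0 unfolding t_def by linarith
  have "Suc k0 * M mod s = (t + M) mod s"
    unfolding t_def by (metis add.commute mod_add_left_eq mult_Suc)
  moreover have "(t + M) mod s < s" using d by simp
  moreover have "d * Suc k0 = d * k0 + d" by simp
  ultimately have tM: "(t + M) mod s + s \<le> d * k0 + d"
    using gap[of "Suc k0"] k0_less k0 d by linarith
  show False
  proof (cases "t + M < s")
    case True
    then have M_le: "M + 2 \<le> 2 * d" using tM k0 by simp
    \<comment> \<open>The residue of \<open>k * M\<close> is the overshoot \<open>k * M - s\<close>.
      It is below \<open>M < 2 * d \<le> d * k\<close>, and \<open>d < M\<close> gives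
      \<open>d * k < k * M\<close>, so both alternatives of \<open>gap\<close> fail.\<close>
    obtain k where k: "s \<le> M * k" "M * k < s + M"
      using ceiling_multiple[of M s] dM by auto
    have k2: "2 \<le> k"
    proof (rule ccontr)
      assume "\<not> 2 \<le> k"
      then have "k = 0 \<or> k = 1" by auto
      then show False using k M by auto
    qed
    then have k_pos: "0 < k" by simp
    have "2 * k \<le> M * k" using dM d by (intro mult_right_mono) auto
    then have k_less: "k < s" using k M by linarith
    have "k * M = (k * M - s) + s" using k by (simp add: mult.commute)
    then have "k * M mod s = (k * M - s) mod s" by (metis mod_add_self2)
    also have "\<dots> = k * M - s" using k M by (simp add: mult.commute)
    finally have r: "k * M mod s = k * M - s" .
    have "d * 2 \<le> d * k" using k2 by simp
    moreover have "d * k < M * k" using dM k2 by simp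
    ultimately show False
      using gap[OF k_pos k_less] k k2 M_le unfolding r mult.commute[of M k] by linarith
  next
    case False
    define u where "u = s - M"
    have u: "0 < u" "u < d" "u + d < s" "s = M + u"
      using False t k0 M dM by (auto simp: u_def)
    \<comment> \<open>Modulo \<open>s\<close>, \<open>M\<close> acts as \<open>- u\<close>, so the
      residue is \<open>s - u * k\<close>; refuting \<open>gap\<close> then amounts to
      \<open>s \<le> (u + d) * k < 2 * s\<close>.\<close>
    obtain k where k: "s \<le> (u + d) * k" "(u + d) * k < s + (u + d)"
      using ceiling_multiple[of "u + d" s] u by auto
    have k_pos: "0 < k" using k d by (cases k) auto
    have ku: "u * k < s"
    proof -
      have "(2 * u) * k \<le> (u + d) * k" using u by (intro mult_right_mono) auto
      then show ?thesis using k u by linarith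
    qed
    have k_less: "k < s"
    proof -
      have "2 * k \<le> (u + d) * k" using u by (intro mult_right_mono) auto
      then show ?thesis using k u by linarith
    qed
    obtain k' where k': "k = Suc k'" using k_pos by (cases k) auto
    have "k * M + u * k = k' * s + s" using u k' by (simp add: algebra_simps)
    then have "k * M = k' * s + (s - u * k)" using ku by linarith
    then have "k * M mod s = (s - u * k) mod s" by simp
    also have "\<dots> = s - u * k" using u k_pos by simp
    finally show False
      using gap[OF k_pos k_less] k u ku unfolding distrib_right by linarith
  qed
qed

section \<open>Power sums over a finite field\<close>

lemma pow_card_minus_1:
  fixes x :: "'a::{field,finite}"
  assumes "x \<noteq> 0"
  shows "x ^ (CARD('a) - 1) = 1"
proof -
  have "(\<Prod>y\<in>UNIV - {0}. x * y) = (\<Prod>y\<in>UNIV - {0}. y)"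
    by (rule prod.reindex_bij_witness[of _ "\<lambda>y. y / x" "\<lambda>y. x * y"]) (use assms in auto)
  then have "x ^ (CARD('a) - 1) * \<Prod>(UNIV - {0}) = \<Prod>(UNIV - {0 :: 'a})"
    by (simp add: prod.distrib)
  then show ?thesis by simp
qed

lemma pow_mod_card_minus_1:
  fixes x :: "'a::{field,finite}"
  assumes "x \<noteq> 0"
  shows "x ^ (i mod (CARD('a) - 1)) = x ^ i"
proof -
  have "x ^ i = x ^ ((CARD('a) - 1) * (i div (CARD('a) - 1)) + i mod (CARD('a) - 1))" by simp
  then show ?thesis by (simp only: power_add power_mult pow_card_minus_1[OF assms]) simp
qed

text \<open>Translation by 1 permutes the ring, so adding 1 to every element leaves the total sum
  unchanged.\<close>

lemma of_nat_card_eq_0: "of_nat CARD('a::{ring_1,finite}) = (0 :: 'a)"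
proof -
  have "(\<Sum>x::'a\<in>UNIV. x) = (\<Sum>x::'a\<in>UNIV. x + 1)"
    by (rule sum.reindex_bij_witness[of _ "\<lambda>x. x + 1" "\<lambda>x. x - 1"]) auto
  then show ?thesis by (simp add: sum.distrib)
qed

lemma sum_pow_dvd:
  assumes "CARD('a::{field,finite}) - 1 dvd i" "0 < i"
  shows "(\<Sum>x::'a\<in>UNIV. x ^ i) = - 1"
proof -
  have card: "1 \<le> CARD('a)" using finite_UNIV_card_ge_0[where 'a = 'a] by simp
  have "(\<Sum>x::'a\<in>UNIV. x ^ i) = (\<Sum>x::'a\<in>UNIV - {0}. x ^ i)"
    using assms by (simp add: sum.remove[of UNIV "0 :: 'a"])
  also have "\<dots> = (\<Sum>x::'a\<in>UNIV - {0}. 1)"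
    using assms(1) by (intro sum.cong) (auto simp: power_mult pow_card_minus_1 simp del: One_nat_def elim!: dvdE)
  also have "\<dots> = - 1"
    using card of_nat_card_eq_0[where 'a = 'a] by (simp add: of_nat_diff)
  finally show ?thesis .
qed

text \<open>Scaling by some nonzero \<open>g\<close> with \<open>g ^ i \<noteq> 1\<close> permutes
  the field but multiplies the sum by \<open>g ^ i\<close>.\<close>

lemma sum_pow_not_dvd:
  assumes "\<not> CARD('a::{field,finite}) - 1 dvd i"
  shows "(\<Sum>x::'a\<in>UNIV. x ^ i) = 0"
proof -
  define r where "r = i mod (CARD('a) - 1)"
  have r0: "0 < r" using assms unfolding r_def by (metis mod_eq_0_iff_dvd gr0I)
  have card: "0 < CARD('a) - 1"
    using card_mono[of UNIV "{0, 1 :: 'a}"] by simp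
  have r: "r < CARD('a) - 1" using card by (simp add: r_def)
  have pow_r: "x ^ i = x ^ r" if "x \<noteq> 0" for x :: 'a
    using pow_mod_card_minus_1[OF that] by (simp add: r_def)
  \<comment> \<open>The nonzero polynomial \<open>x ^ r - 1\<close> has at most \<open>r\<close>
    roots, too few to cover all nonzero elements.\<close>
  obtain g :: 'a where g: "g \<noteq> 0" "g ^ r \<noteq> 1"
  proof (rule ccontr)
    assume "\<not> thesis"
    then have "UNIV - {0} \<subseteq> {x::'a. poly (monom 1 r - 1) x = 0}"
      using that by (auto simp: poly_monom)
    then have "CARD('a) - 1 \<le> card {x::'a. poly (monom 1 r - 1) x = 0}"
      by (metis card_Diff_singleton card_mono finite UNIV_I)
    moreover have "degree (monom 1 r - 1 :: 'a poly) \<le> r"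
      by (intro degree_diff_le) (auto simp: degree_monom_le)
    moreover have "coeff (monom 1 r - 1 :: 'a poly) r \<noteq> 0"
      using r0 by simp
    then have "monom 1 r - 1 \<noteq> (0 :: 'a poly)" by force
    ultimately show False
      using card_poly_roots_bound[of "monom 1 r - 1 :: 'a poly"] r by linarith
  qed
  have "(\<Sum>x::'a\<in>UNIV. x ^ i) = (\<Sum>x::'a\<in>UNIV. (g * x) ^ i)"
    by (rule sum.reindex_bij_witness[of _ "\<lambda>x. g * x" "\<lambda>x. x / g"]) (use g in auto)
  also have "\<dots> = g ^ i * (\<Sum>x::'a\<in>UNIV. x ^ i)"
    by (simp add: power_mult_distrib sum_distrib_left)
  finally show ?thesis using g pow_r by auto
qed

lemma sum_pow_inj_eq_0:
  fixes f :: "'a::{field,finite} \<Rightarrow> 'a"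
  assumes "inj f" "\<not> CARD('a) - 1 dvd i"
  shows "(\<Sum>x\<in>UNIV. f x ^ i) = 0"
proof -
  have "bij f" using assms(1) by (simp add: bij_def finite_UNIV_inj_surj)
  then have "(\<Sum>x\<in>UNIV. f x ^ i) = (\<Sum>x\<in>UNIV. x ^ i)"
    using sum.reindex_bij_betw[of f UNIV UNIV "\<lambda>x. x ^ i"] by simp
  then show ?thesis using sum_pow_not_dvd[OF assms(2)] by simp
qed

text \<open>The coefficient divides \<open>fact N\<close>, which is prime to the characteristic
  \<open>p > N\<close>.\<close>

lemma of_nat_choose_neq_0:
  assumes "CARD('a::{field,finite}) = p" "prime p" "N < p" "j \<le> N"
  shows "of_nat (N choose j) \<noteq> (0 :: 'a)"
proof
  assume "of_nat (N choose j) = (0 :: 'a)"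
  then have "CHAR('a) dvd N choose j" by (simp add: of_nat_eq_0_iff_char_dvd)
  moreover have "CHAR('a) = p"
    using of_nat_card_eq_0[where 'a = 'a] assms CHAR_not_1[where 'a = 'a]
    by (metis of_nat_eq_0_iff_char_dvd prime_nat_iff One_nat_def)
  ultimately have "p dvd fact N"
    using binomial_fact_lemma[OF assms(4)] by (metis dvd_mult)
  then show False using assms by (simp add: prime_dvd_fact_iff)
qed

text \<open>The power sum of exponent \<open>N\<close> vanishes for a permutation, but a lone index
  \<open>j\<close> would leave exactly one nonzero term in its expansion.\<close>

lemma permutation_binomial_exponent_not_unique:
  fixes a :: "'a::{field,finite}"
  assumes p: "prime p" "CARD('a) = p" and a: "a \<noteq> 0" and mn: "0 < m" "m < n"
    and inj: "inj (\<lambda>x. a * x ^ n + x ^ m)"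
    and N: "0 < N" "N < p - 1" and j: "j \<le> N" "p - 1 dvd m * N + (n - m) * j"
  shows "\<exists>i\<le>N. i \<noteq> j \<and> p - 1 dvd m * N + (n - m) * i"
proof (rule ccontr)
  assume uniq: "\<not> ?thesis"
  have expand: "(a * x ^ n + x ^ m) ^ N
      = (\<Sum>i\<le>N. of_nat (N choose i) * a ^ i * x ^ (m * N + (n - m) * i))" for x
  proof -
    have "(a * x ^ n + x ^ m) ^ N
        = (\<Sum>i\<le>N. of_nat (N choose i) * (a * x ^ n) ^ i * (x ^ m) ^ (N - i))"
      by (rule binomial_ring)
    also have "\<dots> = (\<Sum>i\<le>N. of_nat (N choose i) * a ^ i * x ^ (m * N + (n - m) * i))"
    proof (rule sum.cong[OF refl])
      fix i assume "i \<in> {..N}"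
      then have "n * i + m * (N - i) = m * N + (n - m) * i"
        using mn by (auto simp: le_iff_add algebra_simps dest!: less_imp_le)
      then show "of_nat (N choose i) * (a * x ^ n) ^ i * (x ^ m) ^ (N - i)
          = of_nat (N choose i) * a ^ i * x ^ (m * N + (n - m) * i)"
        by (metis (no_types, lifting) mult.assoc power_add power_mult power_mult_distrib)
    qed
    finally show ?thesis .
  qed
  have "0 = (\<Sum>x\<in>UNIV. (a * x ^ n + x ^ m) ^ N)"
    using sum_pow_inj_eq_0[OF inj, of N] N p by (metis dvd_imp_le not_le)
  also have "\<dots> = (\<Sum>i\<le>N. of_nat (N choose i) * a ^ i * (\<Sum>x\<in>UNIV. x ^ (m * N + (n - m) * i)))"
    unfolding expand by (subst sum.swap) (simp add: sum_distrib_left)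
  also have "\<dots> = (\<Sum>i\<in>{j}. of_nat (N choose i) * a ^ i * (\<Sum>x\<in>UNIV. x ^ (m * N + (n - m) * i)))"
    using uniq j p by (intro sum.mono_neutral_right) (auto simp: sum_pow_not_dvd)
  also have "\<dots> = - (of_nat (N choose j) * a ^ j)"
    using j p mn N by (simp add: sum_pow_dvd)
  finally show False
    using of_nat_choose_neq_0[OF p(2,1), of N j] a j N by simp
qed

theorem theorem7:
  fixes p n m d :: nat and a :: "'a::{field,finite}"
  assumes "prime p" and "CARD('a) = p"
    and "0 < m" and "m < n"
    and "a \<noteq> 0"
    and "d = gcd (n - m) (p - 1)"
    and "permutation_poly (monom a n + monom 1 m)"
  shows "p - 1 \<le> (d - 1) * d"
proof (rule ccontr)
  assume neg: "\<not> ?thesis"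
  define f where "f = (\<lambda>x. a * x ^ n + x ^ m)"
  have "poly (monom a n + monom 1 m) = f" by (simp add: f_def poly_monom fun_eq_iff)
  then have inj: "inj f" using assms(7) by (simp add: permutation_poly_def)
  have p1: "0 < p - 1" using prime_gt_1_nat[OF assms(1)] by simp
  have d_pos: "0 < d" using assms(4,6) by simp
  obtain s where s: "p - 1 = d * s" using assms(6) by (metis dvdE gcd_dvd2)
  obtain e where e: "n - m = d * e" using assms(6) by (metis dvdE gcd_dvd1)
  have s_pos: "0 < s" using s p1 by (cases s) auto
  have "d * gcd e s = d"
    using assms(6) unfolding e s by (simp add: gcd_mult_distrib_nat)
  then have cop: "coprime e s" using d_pos by (simp add: coprime_iff_gcd_eq_1)
  have ds: "d \<le> s" using neg s d_pos by (simp add: mult.commute)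
  have d2: "2 \<le> d"
  proof (rule ccontr)
    assume "\<not> 2 \<le> d"
    then have "d = 1" using d_pos by simp
    then have "coprime (n - m) (p - 1)"
      using assms(6) by (metis coprime_iff_gcd_eq_1)
    then obtain c where c: "[(n - m) * c = 1] (mod (p - 1))"
      using cong_solve_coprime_nat by auto
    \<comment> \<open>As \<open>c\<close> inverts \<open>n - m\<close> modulo \<open>p - 1\<close>,
      this \<open>x\<close> solves \<open>x ^ (n - m) = - 1 / a\<close>, so
      \<open>f x = 0 = f 0\<close>.\<close>
    define x where "x = (- 1 / a) ^ c"
    have ne: "- 1 / a \<noteq> 0" using assms(5) by simp
    have x0: "x \<noteq> 0" unfolding x_def using ne by simp
    have "x ^ (n - m) = (- 1 / a) ^ ((n - m) * c)"
      by (simp only: x_def mult.commute[of "n - m"] power_mult)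
    also have "\<dots> = (- 1 / a) ^ 1"
      using c pow_mod_card_minus_1[OF ne] unfolding cong_def assms(2) by metis
    finally have "x ^ (n - m) = - 1 / a" by simp
    moreover have "x ^ n = x ^ (n - m) * x ^ m" using assms(4) by (simp flip: power_add)
    ultimately have "f x = f 0" using assms(3,4,5) by (simp add: f_def power_0_left)
    then show False using x0 inj by (auto dest: injD)
  qed
  obtain v where v: "[e * v = 1] (mod s)" using cong_solve_coprime_nat[OF cop] by auto
  \<comment> \<open>The factor \<open>s - 1\<close> stands for -1 and \<open>v\<close> inverts
    \<open>e\<close>, so \<open>M\<close> represents \<open>- m / e\<close> modulo
    \<open>s\<close>.\<close>
  define M where "M = (s - 1) * m * v mod s"
  have Ms: "M < s" using s_pos by (simp add: M_def)
  have "[e * M = (e * v) * ((s - 1) * m)] (mod s)"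
    unfolding M_def cong_def by (simp add: mod_mult_right_eq ac_simps)
  also have "[(e * v) * ((s - 1) * m) = 1 * ((s - 1) * m)] (mod s)"
    using v by (rule cong_mult) simp
  finally have "[m + e * M = m + (s - 1) * m] (mod s)"
    by (simp add: cong_add_lcancel_nat)
  moreover have "m + (s - 1) * m = s * m" using s_pos by (cases s) auto
  ultimately have eM: "s dvd m + e * M" by (simp add: cong_0_iff cong_def mod_eq_0_iff_dvd)
  have exponent: "p - 1 dvd m * (d * k) + (n - m) * i \<longleftrightarrow> [i = k * M] (mod s)" for i k
  proof -
    have "p - 1 dvd m * (d * k) + (n - m) * i \<longleftrightarrow> d * s dvd d * (m * k + e * i)"
      unfolding s e by (simp add: algebra_simps)
    also have "\<dots> \<longleftrightarrow> s dvd m * k + e * i" using d_pos by simp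
    also have "\<dots> \<longleftrightarrow> [m * k + e * i = k * (m + e * M)] (mod s)"
      using eM by (simp add: cong_def mod_eq_0_iff_dvd)
    also have "\<dots> \<longleftrightarrow> [m * k + e * i = m * k + e * (k * M)] (mod s)"
      by (simp add: algebra_simps)
    also have "\<dots> \<longleftrightarrow> [e * i = e * (k * M)] (mod s)" by (rule cong_add_lcancel_nat)
    also have "\<dots> \<longleftrightarrow> [i = k * M] (mod s)" using cop by (rule cong_mult_lcancel_nat)
    finally show ?thesis .
  qed
  \<comment> \<open>Otherwise the residue of \<open>k * M\<close> is the only contributing index up
    to \<open>d * k\<close>: any other one is larger by at least \<open>s\<close>.\<close>
  have avoid: "d * k < k * M mod s \<or> k * M mod s + s \<le> d * k" if k: "0 < k" "k < s" for k
  proof (rule ccontr)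
    assume "\<not> ?thesis"
    then have r: "k * M mod s \<le> d * k" "d * k < k * M mod s + s" by auto
    have "d * k < p - 1" using k d_pos unfolding s by simp
    then obtain i where i: "i \<le> d * k" "i \<noteq> k * M mod s" "[i = k * M] (mod s)"
      using permutation_binomial_exponent_not_unique[OF assms(1,2,5,3,4) inj[unfolded f_def],
          of "d * k" "k * M mod s"] r k d_pos
      unfolding exponent by (auto simp: cong_def)
    have "i mod s = k * M mod s" using i by (simp add: cong_def)
    then have "i = s * (i div s) + k * M mod s" by (metis mult_div_mod_eq)
    moreover from this i have "i div s \<noteq> 0" by (metis add_0 mult_0_right)
    then have "s * 1 \<le> s * (i div s)" by (intro mult_left_mono) auto
    ultimately show False using i r by linarith
  qed
  show False
  proof (cases "d < s")
    case True
    then show False using multiples_enter_window[OF d2 True Ms] avoid by (metis not_le)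
  next
    case False
    then have sd: "s = d" using ds by simp
    then have "M = 0" using avoid[of 1] d2 Ms by auto
    then obtain m' where m': "m = d * m'" using eM sd by auto
    have "n = d * (m' + e)" using e m' assms(4) by (simp add: algebra_simps)
    then have "f = (\<lambda>y. a * y ^ (m' + e) + y ^ m') \<circ> (\<lambda>x. x ^ d)"
      by (simp add: f_def m' fun_eq_iff power_mult)
    then have "inj (\<lambda>x::'a. x ^ d)" using inj by (metis inj_on_imageI2)
    \<comment> \<open>Injectivity of \<open>x ^ d\<close> makes this sum 0, as
      \<open>0 < s < p - 1\<close>; but its terms are \<open>x ^ (p - 1)\<close>, which sum to
      -1.\<close>
    then have "(\<Sum>x::'a\<in>UNIV. (x ^ d) ^ s) = 0"
      using s d2 sd assms(2) by (intro sum_pow_inj_eq_0) (auto dest: dvd_imp_le)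
    moreover have "(\<Sum>x::'a\<in>UNIV. (x ^ d) ^ s) = - 1"
      using s assms(2) p1 by (simp add: sum_pow_dvd flip: power_mult)
    ultimately show False by simp
  qed
qed

end
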